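(* Let $\{\mathbf{X}^n\}_{n\in\mathbb{N}_0}$ be a combinatorially visual approximation (of some width $w\in\mathbb{N}_0$) of a set $S$. Then the tile graph $\Gamma=\Gamma(\{\mathbf{X}^n\})$ is Gromov hyperbolic, that is, there exists a constant $C\ge0$ such that $$(X\cdot Y)\ge\min\{(X\cdot Z),(Z\cdot Y)\}-C$$ for all $X,Y,Z\in\mathbf{X}=\bigsqcup_{n\in\mathbb{N}_0}\mathbf{X}^n$.
   Context: $\mathbb{N}_0=\{0,1,2,\dots\}$. Let $\{\mathbf{X}^n\}_{n\in\mathbb{N}_0}$ be a sequence of covers of a set $S$ (each $\mathbf{X}^n$ is a collection, possibly infinite, of subsets of $S$ whose union is $S$). Elements of $\mathbf{X}^n$ are called $n$-tiles. A chain of $n$-tiles of length $k$ from $X\in\mathbf{X}^n$ to $Y\in\mathbf{X}^n$ is a finite sequence $X_0=X,X_1,\dots,X_k=Y$ of $n$-tiles with $X_j\cap X_{j+1}\ne\emptyset$ for all $j<k$. For $w\in\mathbb{N}_0$ and $X\in\mathbf{X}^n$, $U_w(X)$ is the union of all $Y\in\mathbf{X}^n$ for which there is a chain of $n$-tiles from $X$ to $Y$ of length $\le w$. For $x,y\in S$, $m_w(x,y)\in\mathbb{N}_0\cup\{\infty\}$ is the supremum of all $n\in\mathbb{N}_0$ for which there exist $X,Y\in\mathbf{X}^n$ with $x\in X$, $y\in Y$ and $U_w(X)\cap U_w(Y)\ne\emptyset$. A sequence $\{\mathbf{X}^n\}_{n\in\mathbb{N}_0}$ of covers of $S$ with $\mathbf{X}^0=\{S\}$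 is a combinatorially visual approximation of width $w$ for $S$ if there is a constant $C\ge0$ such that: (a) $m_w(x,y)\in\mathbb{N}_0$ for all distinct $x,y\in S$; (b) for all $n\in\mathbb{N}_0$ and $X^n\in\mathbf{X}^n$ there exist $x,y\in X^n$ with $m_w(x,y)\le n+C$; (c) if $n\in\mathbb{N}_0$, $X^n,Y^n\in\mathbf{X}^n$ and $U_w(X^n)\cap U_w(Y^n)=\emptyset$, then $m_w(x,y)\le n+C$ for all $x\in X^n$, $y\in Y^n$; (d) $m_w(x,y)\ge\min\{m_w(x,z),m_w(z,y)\}-C$ for all $x,y,z\in S$. Tile graph: let $\mathbf{X}=\bigsqcup_{n}\mathbf{X}^n$ be the formal disjoint union (the same subset occurring on two different levels gives two different elements), and let $|X|=n$ be the level of $X\in\mathbf{X}^n$. The tile graph $\Gamma=\Gamma(\{\mathbf{X}^n\})$ has vertex set $\mathbf{X}$; two distinct vertices $X,Y$ are joined by an edge iff $X\cap Y\neq\emptyset$ and $\big||X|-|Y|\big|\le1$. $|X-Y|$ denotes the combinatorial (path) distance of $X,Y\in\mathbf{X}$ in $\Gamma$. The Gromov product (with respect to the base point $S\in\mathbf{X}^0$) is $(X\cdot Y)=\frac12\big(|X|+|Y|-|X-Y|\big)$. *)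

theory Defs
  imports "HOL-Library.Extended_Real"
begin

text \<open>A sequence of covers of \<open>S\<close> is a function \<open>\<X> :: nat \<Rightarrow> 'a set set\<close>; the \<open>n\<close>-tiles are the
  elements of \<open>\<X> n\<close>.\<close>

definition cover_sequence :: "'a set \<Rightarrow> (nat \<Rightarrow> 'a set set) \<Rightarrow> bool" where
  "cover_sequence S \<X> \<longleftrightarrow> (\<forall>n. (\<forall>X\<in>\<X> n. X \<subseteq> S) \<and> \<Union>(\<X> n) = S)"

text \<open>Only the values \<open>c 0, \<dots>, c k\<close> of \<open>c\<close> are relevant.\<close>

definition tile_chain ::
  "(nat \<Rightarrow> 'a set set) \<Rightarrow> nat \<Rightarrow> nat \<Rightarrow> 'a set \<Rightarrow> 'a set \<Rightarrow> bool" where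
  "tile_chain \<X> n k X Y \<longleftrightarrow>
     (\<exists>c. c 0 = X \<and> c k = Y \<and> (\<forall>j\<le>k. c j \<in> \<X> n) \<and> (\<forall>j<k. c j \<inter> c (Suc j) \<noteq> {}))"

definition tile_nbhd :: "(nat \<Rightarrow> 'a set set) \<Rightarrow> nat \<Rightarrow> nat \<Rightarrow> 'a set \<Rightarrow> 'a set" where
  "tile_nbhd \<X> w n X = \<Union>{Y \<in> \<X> n. \<exists>k\<le>w. tile_chain \<X> n k X Y}"

definition sep_level :: "(nat \<Rightarrow> 'a set set) \<Rightarrow> nat \<Rightarrow> 'a \<Rightarrow> 'a \<Rightarrow> enat" where
  "sep_level \<X> w x y =
     Sup {enat n | n. \<exists>X\<in>\<X> n. \<exists>Y\<in>\<X> n.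
            x \<in> X \<and> y \<in> Y \<and> tile_nbhd \<X> w n X \<inter> tile_nbhd \<X> w n Y \<noteq> {}}"

text \<open>The constant \<open>C\<close> is real, so the inequalities between possibly infinite levels are stated
  in \<^typ>\<open>ereal\<close>, where \<open>\<infinity> - C = \<infinity>\<close>.\<close>

definition comb_visual_approx :: "'a set \<Rightarrow> nat \<Rightarrow> (nat \<Rightarrow> 'a set set) \<Rightarrow> bool" where
  "comb_visual_approx S w \<X> \<longleftrightarrow>
     cover_sequence S \<X> \<and> \<X> 0 = {S} \<and>
     (\<exists>C::real. C \<ge> 0 \<and>
        (\<forall>x\<in>S. \<forall>y\<in>S. x \<noteq> y \<longrightarrow> sep_level \<X> w x y \<noteq> \<infinity>) \<and>
        (\<forall>n. \<forall>X\<in>\<X> n. \<exists>x\<in>X. \<exists>y\<in>X.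
           ereal_of_enat (sep_level \<X> w x y) \<le> ereal (real n + C)) \<and>
        (\<forall>n. \<forall>X\<in>\<X> n. \<forall>Y\<in>\<X> n. tile_nbhd \<X> w n X \<inter> tile_nbhd \<X> w n Y = {} \<longrightarrow>
           (\<forall>x\<in>X. \<forall>y\<in>Y. ereal_of_enat (sep_level \<X> w x y) \<le> ereal (real n + C))) \<and>
        (\<forall>x\<in>S. \<forall>y\<in>S. \<forall>z\<in>S.
           ereal_of_enat (sep_level \<X> w x y)
             \<ge> min (ereal_of_enat (sep_level \<X> w x z)) (ereal_of_enat (sep_level \<X> w z y))
                - ereal C))"

text \<open>A vertex of the tile graph is a pair \<open>(n, X)\<close> with \<open>X \<in> \<X> n\<close>, so that its level is
  \<open>fst (n, X)\<close> and a set occurring on two levels yields two vertices.\<close>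

definition tile_vertices :: "(nat \<Rightarrow> 'a set set) \<Rightarrow> (nat \<times> 'a set) set" where
  "tile_vertices \<X> = (SIGMA n:UNIV. \<X> n)"

definition tile_edge :: "(nat \<Rightarrow> 'a set set) \<Rightarrow> nat \<times> 'a set \<Rightarrow> nat \<times> 'a set \<Rightarrow> bool" where
  "tile_edge \<X> u v \<longleftrightarrow>
     u \<in> tile_vertices \<X> \<and> v \<in> tile_vertices \<X> \<and> u \<noteq> v \<and>
     snd u \<inter> snd v \<noteq> {} \<and> \<bar>int (fst u) - int (fst v)\<bar> \<le> 1"

definition tile_walk ::
  "(nat \<Rightarrow> 'a set set) \<Rightarrow> nat \<Rightarrow> nat \<times> 'a set \<Rightarrow> nat \<times> 'a set \<Rightarrow> bool" where
  "tile_walk \<X> k u v \<longleftrightarrow>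
     (\<exists>p. p 0 = u \<and> p k = v \<and> (\<forall>j\<le>k. p j \<in> tile_vertices \<X>) \<and>
          (\<forall>j<k. tile_edge \<X> (p j) (p (Suc j))))"

text \<open>This is only meaningful if \<open>u\<close> and \<open>v\<close> are joined by a walk; by \<open>tile_graph_connected\<close>
  below this is always the case in the tile graph of a combinatorially visual approximation.\<close>

definition tile_dist :: "(nat \<Rightarrow> 'a set set) \<Rightarrow> nat \<times> 'a set \<Rightarrow> nat \<times> 'a set \<Rightarrow> nat" where
  "tile_dist \<X> u v = (LEAST k. tile_walk \<X> k u v)"

definition gromov_product ::
  "(nat \<Rightarrow> 'a set set) \<Rightarrow> nat \<times> 'a set \<Rightarrow> nat \<times> 'a set \<Rightarrow> real" where
  "gromov_product \<X> u v =
     (real (fst u) + real (fst v) - real (tile_dist \<X> u v)) / 2"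

lemma tile_walk_iff_relpowp:
  assumes "u \<in> tile_vertices \<X>"
  shows "tile_walk \<X> k u v \<longleftrightarrow> (tile_edge \<X> ^^ k) u v"
proof
  assume "tile_walk \<X> k u v"
  then show "(tile_edge \<X> ^^ k) u v"
    unfolding tile_walk_def relpowp_fun_conv by blast
next
  assume "(tile_edge \<X> ^^ k) u v"
  then obtain p where p: "p 0 = u" "p k = v" "\<forall>j<k. tile_edge \<X> (p j) (p (Suc j))"
    unfolding relpowp_fun_conv by blast
  have "p j \<in> tile_vertices \<X>" if "j \<le> k" for j
  proof (cases j)
    case 0
    then show ?thesis using p(1) assms by simp
  next
    case (Suc i)
    then have "tile_edge \<X> (p i) (p (Suc i))" using p(3) that by simp
    then show ?thesis using Suc unfolding tile_edge_def by simp
  qed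
  with p show "tile_walk \<X> k u v"
    unfolding tile_walk_def by blast
qed

lemma tile_graph_connected:
  assumes "comb_visual_approx S w \<X>" "u \<in> tile_vertices \<X>" "v \<in> tile_vertices \<X>"
  shows "\<exists>k. tile_walk \<X> k u v"
proof -
  have cov: "\<Union>(\<X> n) = S" for n
    using assms(1) unfolding comb_visual_approx_def cover_sequence_def by simp
  have root: "\<X> 0 = {S}"
    using assms(1) unfolding comb_visual_approx_def by simp
  have ne: "X \<noteq> {}" if "X \<in> \<X> n" for n X
  proof -
    have "\<exists>C::real. \<forall>n. \<forall>X\<in>\<X> n. \<exists>x\<in>X. \<exists>y\<in>X.
            ereal_of_enat (sep_level \<X> w x y) \<le> ereal (real n + C)"
      using assms(1) unfolding comb_visual_approx_def by (elim conjE exE) (rule exI)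
    then show ?thesis using that by fast
  qed
  have sym: "symp (tile_edge \<X>)"
    by (rule sympI) (auto simp: tile_edge_def)
  have down: "(tile_edge \<X>)\<^sup>*\<^sup>* (n, X) (0, S)" if "X \<in> \<X> n" for n X
    using that
  proof (induction n arbitrary: X)
    case 0
    then show ?case using root by simp
  next
    case (Suc n)
    obtain x where x: "x \<in> X" using ne[OF Suc.prems] by blast
    then have "x \<in> S" using cov[of "Suc n"] Suc.prems by blast
    then obtain Y where Y: "Y \<in> \<X> n" "x \<in> Y" using cov[of n] by blast
    have "tile_edge \<X> (Suc n, X) (n, Y)"
      using Suc.prems Y x by (auto simp: tile_edge_def tile_vertices_def)
    then show ?case
      using Suc.IH[OF Y(1)] by (rule converse_rtranclp_into_rtranclp)
  qed
  have "(tile_edge \<X>)\<^sup>*\<^sup>* u (0, S)" "(tile_edge \<X>)\<^sup>*\<^sup>* v (0, S)"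
    using assms(2,3) down by (auto simp: tile_vertices_def)
  then have "(tile_edge \<X>)\<^sup>*\<^sup>* u v"
    using rtranclp_trans sympD[OF symp_rtranclp[OF sym]] by fast
  then show ?thesis
    using tile_walk_iff_relpowp[OF assms(2)] by (auto dest: rtranclp_imp_relpowp)
qed

end

theory Submission
  imports Defs
begin

text \<open>
  Write \<open>m x y\<close> for the separation level and \<open>|X|\<close> for the level of a tile. The Gromov product
  of two tiles \<open>X\<close>, \<open>Y\<close> is, up to an additive constant, the infimum of \<open>m x y\<close> over
  \<open>x \<in> X\<close>, \<open>y \<in> Y\<close>; hyperbolicity is then the almost ultrametric inequality (d) for \<open>m\<close>. The
  comparison is only needed in the following two halves.

  \<^item> For all \<open>x \<in> X\<close>, \<open>y \<in> Y\<close> the number \<open>m x y\<close> is at least \<open>(X \<cdot> Y)\<close> minus a constant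
    (lemma \<open>gromov_product_le_sep\<close>). Along a geodesic from \<open>X\<close> to \<open>Y\<close> choose points in the
    intersections of consecutive tiles. Two consecutive points share a tile, so \<open>m\<close> of them is at
    least the level of this tile. Levels change by at most one per step, hence they are at least
    \<open>(X \<cdot> Y) + i\<close> at distance \<open>i\<close> from a suitable turning point of the geodesic, up to rounding.
    Repeated use of (d) costs a constant per step, which is too much for a long path; but because
    the levels grow linearly away from the turning point, the loss over the whole path stays
    bounded (lemma \<open>sep_along_growing_chain\<close>).

  \<^item> For some \<open>x \<in> X\<close>, \<open>y \<in> Y\<close> the number \<open>m x y\<close> is at most \<open>(X \<cdot> Y)\<close> plus a constant
    (lemma \<open>exists_sep_le_gromov_product\<close>). By (b) a tile contains two points of separation level
    at most about its own level, and by (d) any third point has separation level at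
    most about \<open>|X|\<close> from one of the two; so \<open>m x y\<close> can be made at most about \<open>min |X| |Y|\<close>. A walk from \<open>X\<close> through
    tiles containing \<open>x\<close> to level \<open>m x y\<close>, then across to a tile containing \<open>y\<close> in a bounded
    number of steps, and through tiles containing \<open>y\<close> to \<open>Y\<close> shows that
    \<open>|X - Y|\<close> is at most \<open>|X| + |Y| - 2 m x y\<close> plus a constant.

  Given \<open>X\<close>, \<open>Y\<close>, \<open>Z\<close>, take \<open>x\<close>, \<open>y\<close> from the second half and any \<open>z \<in> Z\<close>, apply (d) to
  \<open>x\<close>, \<open>y\<close>, \<open>z\<close>, and bound \<open>m x z\<close> and \<open>m z y\<close> from below by the first half.
\<close>

section \<open>Chains in almost ultrametric spaces\<close>

text \<open>The inequality (d) is stated for real lower bounds \<open>a\<close>, so that infinite values of \<open>\<mu>\<close> need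
  no arithmetic.\<close>

locale almost_ultrametric =
  fixes S :: "'a set" and \<mu> :: "'a \<Rightarrow> 'a \<Rightarrow> ereal" and C :: real
  assumes C_nonneg: "C \<ge> 0"
    and self: "x \<in> S \<Longrightarrow> \<mu> x x = \<infinity>"
    and sym: "\<mu> x y = \<mu> y x"
    and ultra: "\<lbrakk>x \<in> S; y \<in> S; z \<in> S; ereal a \<le> \<mu> x z; ereal a \<le> \<mu> z y\<rbrakk>
      \<Longrightarrow> ereal (a - C) \<le> \<mu> x y"
begin

lemma sep_along_chain:
  assumes "\<And>i. i \<le> k \<Longrightarrow> p i \<in> S" "\<And>i. i < k \<Longrightarrow> ereal a \<le> \<mu> (p i) (p (Suc i))"
  shows "ereal (a - C * real k) \<le> \<mu> (p 0) (p k)"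
  using assms
proof (induction k)
  case 0
  then show ?case using self by simp
next
  case (Suc k)
  have 1: "ereal (a - C * real k) \<le> \<mu> (p 0) (p k)"
    by (rule Suc.IH) (auto intro: Suc.prems)
  have "a - C * real k \<le> a" using C_nonneg by simp
  then have 2: "ereal (a - C * real k) \<le> \<mu> (p k) (p (Suc k))"
    using Suc.prems(2)[of k] by (meson ereal_less_eq(3) lessI order_trans)
  have "ereal (a - C * real k - C) \<le> \<mu> (p 0) (p (Suc k))"
    using ultra[OF _ _ _ 1 2] Suc.prems(1) by simp
  then show ?case by (simp add: algebra_simps)
qed

text \<open>The bound does not depend on the length of the chain. Cut off an initial block of \<open>L \<ge> C\<close>
  steps; the block is handled by the previous lemma at the cost \<open>C L\<close>. The rest of
  the chain satisfies the hypothesis with \<open>b + L\<close> in place of \<open>b\<close>, and this gain of \<open>L\<close> compensates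
  for the loss \<open>C\<close> in gluing the two parts, so that the induction reproduces the same constant.\<close>

lemma sep_along_growing_chain:
  assumes L: "C \<le> real L"
    and "\<And>i. i \<le> k \<Longrightarrow> p i \<in> S"
    and "\<And>i. i < k \<Longrightarrow> ereal (b + real i) \<le> \<mu> (p i) (p (Suc i))"
  shows "ereal (b - C * (real L + 1)) \<le> \<mu> (p 0) (p k)"
  using assms(2,3)
proof (induction k arbitrary: p b rule: less_induct)
  case (less k)
  have step: "ereal b \<le> \<mu> (p i) (p (Suc i))" if "i < k" for i
    using less.prems(2)[OF that] by (rule order_trans[rotated]) simp
  have block: "ereal (b - C * real j) \<le> \<mu> (p 0) (p j)" if "j \<le> k" for j
    using sep_along_chain[of j p b] less.prems(1) step that by simp
  show ?case
  proof (cases "k \<le> L \<or> L = 0")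
    case True
    \<comment> \<open>If \<open>L = 0\<close> then \<open>C = 0\<close>, and \<open>block\<close> covers the whole chain without loss.\<close>
    have "C * real k \<le> C * (real L + 1)"
    proof (cases "L = 0")
      case True
      then show ?thesis using L C_nonneg by simp
    next
      case False
      then show ?thesis using True C_nonneg by (intro mult_left_mono) auto
    qed
    then have "ereal (b - C * (real L + 1)) \<le> ereal (b - C * real k)" by simp
    then show ?thesis using block[of k] order_trans by blast
  next
    case False
    have "ereal (b + real L - C * (real L + 1)) \<le> \<mu> (p (0 + L)) (p ((k - L) + L))"
    proof (rule less.IH[of "k - L" "\<lambda>i. p (i + L)"])
      show "k - L < k" using False by simp
      show "p (i + L) \<in> S" if "i \<le> k - L" for i
        by (rule less.prems(1)) (use that False in linarith)
      show "ereal (b + real L + real i) \<le> \<mu> (p (i + L)) (p (Suc i + L))"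
        if "i < k - L" for i
        using less.prems(2)[of "i + L"] that by (simp add: algebra_simps)
    qed
    then have "ereal (b + real L - C * (real L + 1)) \<le> \<mu> (p L) (p k)"
      using False by simp
    moreover have "b - C * real L \<le> b + real L - C * (real L + 1)"
      using L by (simp add: algebra_simps)
    ultimately have "ereal (b - C * real L) \<le> \<mu> (p L) (p k)"
      by (meson ereal_less_eq(3) order_trans)
    then have "ereal (b - C * real L - C) \<le> \<mu> (p 0) (p k)"
      using ultra[OF _ _ _ block[of L]] less.prems(1) False by simp
    then show ?thesis by (simp add: algebra_simps)
  qed
qed

end

section \<open>Separation levels\<close>

lemma self_in_tile_nbhd: "X \<in> \<X> n \<Longrightarrow> X \<subseteq> tile_nbhd \<X> w n X"
  unfolding tile_nbhd_def tile_chain_def by fastforce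

lemma sep_level_commute: "sep_level \<X> w x y = sep_level \<X> w y x"
  unfolding sep_level_def by (rule arg_cong[where f = Sup]) blast

lemma sep_level_ge_common_tile:
  assumes "X \<in> \<X> n" "x \<in> X" "y \<in> X"
  shows "enat n \<le> sep_level \<X> w x y"
proof -
  have "tile_nbhd \<X> w n X \<inter> tile_nbhd \<X> w n X \<noteq> {}"
    using self_in_tile_nbhd[of X \<X> n w] assms by blast
  then show ?thesis
    unfolding sep_level_def using assms by (intro Sup_upper) blast
qed

text \<open>A finite supremum of a nonempty set of levels is a maximum.\<close>

lemma sep_level_attained:
  assumes "\<X> 0 = {S}" "x \<in> S" "y \<in> S" "sep_level \<X> w x y = enat n"
  obtains X Y where "X \<in> \<X> n" "Y \<in> \<X> n" "x \<in> X" "y \<in> Y"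
    "tile_nbhd \<X> w n X \<inter> tile_nbhd \<X> w n Y \<noteq> {}"
proof -
  define A where "A = {enat n | n. \<exists>X\<in>\<X> n. \<exists>Y\<in>\<X> n.
    x \<in> X \<and> y \<in> Y \<and> tile_nbhd \<X> w n X \<inter> tile_nbhd \<X> w n Y \<noteq> {}}"
  have Sup: "Sup A = enat n" using assms(4) by (simp add: A_def sep_level_def)
  have "S \<subseteq> tile_nbhd \<X> w 0 S" by (rule self_in_tile_nbhd) (simp add: assms)
  then have "enat 0 \<in> A" unfolding A_def using assms by blast
  then have "A \<noteq> {}" by blast
  moreover have "finite A" using Sup \<open>A \<noteq> {}\<close> by (auto simp: Sup_enat_def split: if_splits)
  ultimately have "Sup A \<in> A" using Max_in[of A] by (simp add: Sup_enat_def)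
  then show thesis using Sup that unfolding A_def by auto
qed

section \<open>Distances in the tile graph\<close>

lemma relpowp_symp:
  assumes "symp R" "(R ^^ k) a b"
  shows "(R ^^ k) b a"
  using assms(2)
proof (induction k arbitrary: b)
  case 0
  then show ?case by simp
next
  case (Suc k)
  then obtain c where "(R ^^ k) a c" "R c b" by (meson relpowp_Suc_E)
  then show ?case using Suc.IH sympD[OF assms(1)] by (meson relpowp_Suc_I2)
qed

locale visual_approximation =
  fixes S :: "'a set" and w :: nat and \<X> :: "nat \<Rightarrow> 'a set set" and C :: real
  assumes approx: "comb_visual_approx S w \<X>"
    and C_nonneg: "C \<ge> 0"
    and small_tile: "X \<in> \<X> n \<Longrightarrow>
      \<exists>x\<in>X. \<exists>y\<in>X. ereal_of_enat (sep_level \<X> w x y) \<le> ereal (real n + C)"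
    and almost_ultra: "\<lbrakk>x \<in> S; y \<in> S; z \<in> S\<rbrakk> \<Longrightarrow> ereal_of_enat (sep_level \<X> w x y)
      \<ge> min (ereal_of_enat (sep_level \<X> w x z)) (ereal_of_enat (sep_level \<X> w z y)) - ereal C"
begin

abbreviation m :: "'a \<Rightarrow> 'a \<Rightarrow> ereal" where
  "m x y \<equiv> ereal_of_enat (sep_level \<X> w x y)"

abbreviation V :: "(nat \<times> 'a set) set" where
  "V \<equiv> tile_vertices \<X>"

lemma root: "\<X> 0 = {S}"
  using approx unfolding comb_visual_approx_def by (elim conjE)

lemma covers: "cover_sequence S \<X>"
  using approx unfolding comb_visual_approx_def by (elim conjE)

lemma in_some_tile: "x \<in> S \<Longrightarrow> \<exists>X\<in>\<X> n. x \<in> X"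
  using covers unfolding cover_sequence_def by blast

lemma vertex_subset: "u \<in> V \<Longrightarrow> snd u \<subseteq> S"
  using covers unfolding cover_sequence_def by (cases u) (simp add: tile_vertices_def)

lemma vertex_nonempty: "u \<in> V \<Longrightarrow> snd u \<noteq> {}"
  using small_tile[of "snd u" "fst u"] by (auto simp: tile_vertices_def)

lemma shortest_walk:
  assumes "u \<in> V" "v \<in> V"
  shows "(tile_edge \<X> ^^ tile_dist \<X> u v) u v"
  using LeastI_ex[OF tile_graph_connected[OF approx assms]]
  unfolding tile_dist_def tile_walk_iff_relpowp[OF assms(1)] .

lemma tile_dist_le:
  assumes "u \<in> V" "(tile_edge \<X> ^^ k) u v"
  shows "tile_dist \<X> u v \<le> k"
  unfolding tile_dist_def using assms(2) tile_walk_iff_relpowp[OF assms(1)]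
  by (intro Least_le) simp

lemma tile_dist_triangle:
  assumes "u \<in> V" "v \<in> V" "z \<in> V"
  shows "tile_dist \<X> u v \<le> tile_dist \<X> u z + tile_dist \<X> z v"
  using relpowp_trans[OF shortest_walk[OF assms(1,3)] shortest_walk[OF assms(3,2)]]
  by (rule tile_dist_le[OF assms(1)])

lemma tile_dist_commute:
  assumes "u \<in> V" "v \<in> V"
  shows "tile_dist \<X> u v = tile_dist \<X> v u"
proof -
  have "symp (tile_edge \<X>)" by (rule sympI) (auto simp: tile_edge_def)
  then have "tile_dist \<X> a b \<le> tile_dist \<X> b a" if "a \<in> V" "b \<in> V" for a b
    using tile_dist_le[OF that(1) relpowp_symp[OF _ shortest_walk[OF that(2,1)]]] by simp
  then show ?thesis using assms by (meson antisym)
qed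

lemma tile_dist_le_1:
  assumes "u \<in> V" "v \<in> V" "snd u \<inter> snd v \<noteq> {}" "\<bar>int (fst u) - int (fst v)\<bar> \<le> 1"
  shows "tile_dist \<X> u v \<le> 1"
proof (cases "u = v")
  case True
  then show ?thesis using tile_dist_le[OF assms(1), of 0 v] by simp
next
  case False
  then have "tile_edge \<X> u v" using assms by (simp add: tile_edge_def)
  then show ?thesis using tile_dist_le[OF assms(1), of 1 v] by (simp only: relpowp_1)
qed

lemma tile_dist_le_chain_length:
  assumes "tile_chain \<X> n k X Y"
  shows "tile_dist \<X> (n, X) (n, Y) \<le> k"
proof -
  obtain c where c: "c 0 = X" "c k = Y" "\<And>j. j \<le> k \<Longrightarrow> c j \<in> \<X> n"
    "\<And>j. j < k \<Longrightarrow> c j \<inter> c (Suc j) \<noteq> {}"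
    using assms unfolding tile_chain_def by blast
  have V: "(n, c j) \<in> V" if "j \<le> k" for j using c(3)[OF that] by (simp add: tile_vertices_def)
  have "tile_dist \<X> (n, c 0) (n, c j) \<le> j" if "j \<le> k" for j
    using that
  proof (induction j)
    case 0
    then show ?case using tile_dist_le[OF V, of 0 0 "(n, c 0)"] by simp
  next
    case (Suc j)
    have "tile_dist \<X> (n, c j) (n, c (Suc j)) \<le> 1"
      using Suc.prems V c(4)[of j] by (intro tile_dist_le_1) auto
    then show ?case
      using Suc tile_dist_triangle[of "(n, c 0)" "(n, c (Suc j))" "(n, c j)"] V by simp
  qed
  then show ?thesis using c(1,2) by blast
qed

text \<open>Tiles around a common point are joined by a walk through tiles around this point, one on
  each intermediate level; two tiles on the same level may differ, which costs one step more.\<close>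

lemma tile_dist_common_point_above:
  assumes "X \<in> \<X> n" "Y \<in> \<X> (n + d)" "x \<in> X" "x \<in> Y" "x \<in> S"
  shows "tile_dist \<X> (n, X) (n + d, Y) \<le> d + 1"
  using assms(2,4)
proof (induction d arbitrary: Y)
  case 0
  then show ?case using assms tile_dist_le_1[of "(n, X)" "(n, Y)"] by (auto simp: tile_vertices_def)
next
  case (Suc d)
  obtain Z where Z: "Z \<in> \<X> (n + d)" "x \<in> Z" using in_some_tile assms(5) by blast
  have V: "(n, X) \<in> V" "(n + d, Z) \<in> V" "(n + Suc d, Y) \<in> V"
    using assms Z Suc.prems by (auto simp: tile_vertices_def)
  have "tile_dist \<X> (n + d, Z) (n + Suc d, Y) \<le> 1"
    using V Z Suc.prems by (intro tile_dist_le_1) auto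
  then show ?case
    using Suc.IH[OF Z] tile_dist_triangle[OF V(1,3,2)] by linarith
qed

lemma tile_dist_common_point:
  assumes "u \<in> V" "v \<in> V" "x \<in> snd u" "x \<in> snd v"
  shows "real (tile_dist \<X> u v) \<le> \<bar>real (fst u) - real (fst v)\<bar> + 1"
proof -
  have up: "real (tile_dist \<X> a b) \<le> \<bar>real (fst a) - real (fst b)\<bar> + 1"
    if "a \<in> V" "b \<in> V" "x \<in> snd a" "x \<in> snd b" "fst a \<le> fst b" for a b
  proof -
    have "snd a \<in> \<X> (fst a)" "snd b \<in> \<X> (fst a + (fst b - fst a))"
      using that(1,2,5) by (auto simp: tile_vertices_def)
    moreover have "x \<in> S" using vertex_subset[OF that(1)] that(3) by (rule subsetD)
    ultimately have
      "tile_dist \<X> (fst a, snd a) (fst a + (fst b - fst a), snd b) \<le> (fst b - fst a) + 1"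
      using that(3,4) by (intro tile_dist_common_point_above)
    then show ?thesis using that(5) by simp
  qed
  show ?thesis
  proof (cases "fst u \<le> fst v")
    case True
    then show ?thesis using up assms by blast
  next
    case False
    then show ?thesis using up[of v u] assms tile_dist_commute[OF assms(1,2)] by simp
  qed
qed

lemma tile_dist_meeting_nbhds:
  assumes "X \<in> \<X> n" "Y \<in> \<X> n" "tile_nbhd \<X> w n X \<inter> tile_nbhd \<X> w n Y \<noteq> {}"
  shows "tile_dist \<X> (n, X) (n, Y) \<le> 2 * w + 1"
proof -
  obtain X' Y' k l where c: "X' \<in> \<X> n" "Y' \<in> \<X> n" "X' \<inter> Y' \<noteq> {}" "k \<le> w" "l \<le> w"
    "tile_chain \<X> n k X X'" "tile_chain \<X> n l Y Y'"
    using assms(3) unfolding tile_nbhd_def by blast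
  have V: "(n, Z) \<in> V" if "Z \<in> \<X> n" for Z using that by (simp add: tile_vertices_def)
  have "tile_dist \<X> (n, X) (n, X') \<le> w" "tile_dist \<X> (n, Y) (n, Y') \<le> w"
    using tile_dist_le_chain_length[OF c(6)] tile_dist_le_chain_length[OF c(7)] c(4,5) by simp_all
  moreover have "tile_dist \<X> (n, X') (n, Y') \<le> 1" using c V by (intro tile_dist_le_1) auto
  ultimately show ?thesis
    using tile_dist_triangle[of "(n, X)" "(n, Y)" "(n, X')"]
      tile_dist_triangle[of "(n, X')" "(n, Y)" "(n, Y')"]
      tile_dist_commute[of "(n, Y)" "(n, Y')"] V assms(1,2) c(1,2) by simp
qed

section \<open>Comparison of the Gromov product with the separation level\<close>

lemma almost_ultrametric_sep: "almost_ultrametric S m C"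
proof
  show "C \<ge> 0" by (rule C_nonneg)
next
  fix x assume "x \<in> S"
  have "enat n \<le> sep_level \<X> w x x" for n
    using in_some_tile[OF \<open>x \<in> S\<close>] sep_level_ge_common_tile by metis
  then show "m x x = \<infinity>"
    by (metis Suc_ile_eq enat_ord_simps(4) less_irrefl not_infinity_eq ereal_of_enat_simps(2))
next
  show "m x y = m y x" for x y by (simp add: sep_level_commute)
next
  fix x y z a
  assume "x \<in> S" "y \<in> S" "z \<in> S" "ereal a \<le> m x z" "ereal a \<le> m z y"
  then have "ereal a - ereal C \<le> min (m x z) (m z y) - ereal C"
    by (intro ereal_minus_mono) auto
  then show "ereal (a - C) \<le> m x y"
    using almost_ultra[OF \<open>x \<in> S\<close> \<open>y \<in> S\<close> \<open>z \<in> S\<close>] by simp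
qed

sublocale almost_ultrametric S m C
  by (rule almost_ultrametric_sep)

text \<open>For two points of a tile \<open>X\<close> with separation level at most \<open>|X| + C\<close>, the
  inequality (d) forbids that both have larger separation level than \<open>|X| + 2 C\<close> from \<open>y\<close>.\<close>

lemma exists_sep_le_level:
  assumes "u \<in> V" "y \<in> S"
  shows "\<exists>x \<in> snd u. m x y \<le> ereal (real (fst u) + 2 * C)"
proof -
  obtain a b where ab: "a \<in> snd u" "b \<in> snd u" "m a b \<le> ereal (real (fst u) + C)"
    using small_tile[of "snd u" "fst u"] assms(1) unfolding tile_vertices_def by auto
  then have "a \<in> S" "b \<in> S" using vertex_subset[OF assms(1)] by auto
  then have "min (m a y) (m b y) - ereal C \<le> ereal (real (fst u) + C)"
    using almost_ultra[of a b y] ab(3) assms(2) sym[of y b] by (metis order_trans)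
  then have "min (m a y) (m b y) \<le> ereal (real (fst u) + C) + ereal C"
    by (simp add: ereal_minus_le_iff add.commute)
  then have "min (m a y) (m b y) \<le> ereal (real (fst u) + 2 * C)" by (simp add: algebra_simps)
  then show ?thesis using ab by (auto simp: min_le_iff_disj)
qed

text \<open>A walk from \<open>u\<close> to \<open>v\<close> that passes through level \<open>m x y\<close>. If this
  level exceeds those of \<open>u\<close> and \<open>v\<close>, it does so only by a constant; hence both absolute values of
  level differences can be replaced by signed ones.\<close>

lemma sep_le_gromov_product:
  assumes uv: "u \<in> V" "v \<in> V" and xy: "x \<in> snd u" "y \<in> snd v"
    and u: "m x y \<le> ereal (real (fst u) + D)" and v: "m x y \<le> ereal (real (fst v) + D)"
    and D: "D \<ge> 0"
  shows "m x y \<le> ereal (gromov_product \<X> u v + (2 * D + real w + 2))"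
proof -
  obtain n where n: "sep_level \<X> w x y = enat n"
    using u by (cases "sep_level \<X> w x y") auto
  have "x \<in> S" "y \<in> S" using xy vertex_subset[OF uv(1)] vertex_subset[OF uv(2)] by auto
  then obtain X Y where XY: "X \<in> \<X> n" "Y \<in> \<X> n" "x \<in> X" "y \<in> Y"
    "tile_nbhd \<X> w n X \<inter> tile_nbhd \<X> w n Y \<noteq> {}"
    using sep_level_attained[OF root _ _ n] by blast
  have V: "(n, X) \<in> V" "(n, Y) \<in> V" using XY by (simp_all add: tile_vertices_def)
  have "tile_dist \<X> u v \<le> tile_dist \<X> u (n, X) + (tile_dist \<X> (n, X) (n, Y) + tile_dist \<X> (n, Y) v)"
    using tile_dist_triangle[of u v "(n, X)"] tile_dist_triangle[of "(n, X)" v "(n, Y)"] uv V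
    by linarith
  then have "real (tile_dist \<X> u v) \<le> real (tile_dist \<X> u (n, X))
      + (real (tile_dist \<X> (n, X) (n, Y)) + real (tile_dist \<X> (n, Y) v))"
    by linarith
  moreover have "real (tile_dist \<X> u (n, X)) \<le> \<bar>real (fst u) - real n\<bar> + 1"
    using tile_dist_common_point[OF uv(1) V(1) xy(1)] XY by simp
  moreover have "real (tile_dist \<X> (n, Y) v) \<le> \<bar>real n - real (fst v)\<bar> + 1"
    using tile_dist_common_point[OF V(2) uv(2) _ xy(2)] XY by simp
  moreover have "real (tile_dist \<X> (n, X) (n, Y)) \<le> 2 * real w + 1"
    using tile_dist_meeting_nbhds[OF XY(1,2,5)] by linarith
  moreover have "real n \<le> real (fst u) + D" "real n \<le> real (fst v) + D" using u v n by simp_all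
  ultimately have "real (tile_dist \<X> u v)
      \<le> real (fst u) + real (fst v) - 2 * real n + 4 * D + 2 * real w + 3"
    using D by linarith
  then show ?thesis using n by (simp add: gromov_product_def field_simps)
qed

lemma exists_sep_le_gromov_product:
  assumes "u \<in> V" "v \<in> V"
  shows "\<exists>x \<in> snd u. \<exists>y \<in> snd v. m x y \<le> ereal (gromov_product \<X> u v + (4 * C + real w + 2))"
proof -
  have le: "\<exists>x \<in> snd a. \<exists>y \<in> snd b. m x y \<le> ereal (real (fst a) + 2 * C)"
    if "a \<in> V" "b \<in> V" for a b
    using exists_sep_le_level[OF that(1)] vertex_nonempty[OF that(2)] vertex_subset[OF that(2)]
    by blast
  \<comment> \<open>The tile of lower level supplies a bound that serves for both tiles.\<close>
  have "\<exists>x \<in> snd u. \<exists>y \<in> snd v. m x y \<le> ereal (real (min (fst u) (fst v)) + 2 * C)"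
  proof (cases "fst u \<le> fst v")
    case True
    then show ?thesis using le[OF assms] by (simp add: min_def)
  next
    case False
    obtain y x where "y \<in> snd v" "x \<in> snd u" "m y x \<le> ereal (real (fst v) + 2 * C)"
      using le[OF assms(2,1)] by blast
    then show ?thesis using False sym[of y x] by (auto simp: min_def)
  qed
  then obtain x y where xy: "x \<in> snd u" "y \<in> snd v"
    "m x y \<le> ereal (real (min (fst u) (fst v)) + 2 * C)"
    by blast
  then have "m x y \<le> ereal (real (fst u) + 2 * C)" "m x y \<le> ereal (real (fst v) + 2 * C)"
    by (auto elim!: order_trans)
  then show ?thesis
    using sep_le_gromov_product[OF assms xy(1,2), of "2 * C"] xy(1,2) C_nonneg by auto
qed

lemma level_along_walk:
  assumes "\<And>j. j < N \<Longrightarrow> tile_edge \<X> (p j) (p (Suc j))" "i \<le> j" "j \<le> N"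
  shows "\<bar>real (fst (p i)) - real (fst (p j))\<bar> \<le> real j - real i"
  using assms(2,3)
proof (induction j rule: dec_induct)
  case base
  then show ?case by simp
next
  case (step j)
  have "\<bar>int (fst (p j)) - int (fst (p (Suc j)))\<bar> \<le> 1"
    using assms(1)[of j] step.prems by (simp add: tile_edge_def)
  then have "\<bar>real (fst (p j)) - real (fst (p (Suc j)))\<bar> \<le> 1" by linarith
  then show ?case using step by simp
qed

text \<open>The points \<open>q 0 = x, q 1, \<dots>, q N, q (N + 1) = y\<close> lie in consecutive intersections of a
  geodesic \<open>p 0 = u, \<dots>, p N = v\<close>, so that \<open>q i\<close> and \<open>q (i + 1)\<close> share the tile \<open>p i\<close>. The index
  \<open>j\<close> is the turning point, where the two lower bounds \<open>|u| - i\<close> and \<open>|v| - (N - i)\<close> for the level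
  of \<open>p i\<close> agree up to rounding. On both sides of \<open>j\<close> the bound grows by one per step.\<close>

lemma gromov_product_le_sep:
  assumes uv: "u \<in> V" "v \<in> V" and xy: "x \<in> snd u" "y \<in> snd v" and L: "C \<le> real L"
  shows "ereal (gromov_product \<X> u v - (C * (real L + 2) + 1)) \<le> m x y"
proof -
  define N where "N = tile_dist \<X> u v"
  obtain p where p: "p 0 = u" "p N = v" "\<And>j. j < N \<Longrightarrow> tile_edge \<X> (p j) (p (Suc j))"
    using shortest_walk[OF uv] unfolding N_def relpowp_fun_conv by blast
  have pV: "p i \<in> V" if "i \<le> N" for i
    using that uv p(2) p(3)[of i] by (cases "i = N") (auto simp: tile_edge_def)
  have "\<exists>z. z \<in> snd (p i) \<inter> snd (p (Suc i))" if "i < N" for i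
    using p(3)[OF that] by (auto simp: tile_edge_def)
  then obtain r where r: "\<And>i. i < N \<Longrightarrow> r i \<in> snd (p i) \<inter> snd (p (Suc i))" by metis
  define q where "q i = (if i = 0 then x else if i = Suc N then y else r (i - 1))" for i
  have q: "q i \<in> snd (p i)" "q (Suc i) \<in> snd (p i)" if "i \<le> N" for i
    using that r[of i] r[of "i - 1"] xy p(1,2) by (auto simp: q_def)
  have q_sep: "ereal (real (fst (p i))) \<le> m (q i) (q (Suc i))" if "i \<le> N" for i
  proof -
    have "snd (p i) \<in> \<X> (fst (p i))" using pV[OF that] by (auto simp: tile_vertices_def)
    then have "enat (fst (p i)) \<le> sep_level \<X> w (q i) (q (Suc i))"
      using q[OF that] by (rule sep_level_ge_common_tile)
    then show ?thesis by (metis ereal_of_enat_le_iff ereal_of_enat_simps(1))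
  qed
  have qS: "q i \<in> S" if "i \<le> Suc N" for i
  proof (cases "i \<le> N")
    case True
    then show ?thesis using q(1)[of i] vertex_subset[OF pV[of i]] by auto
  next
    case False
    then have "i = Suc N" using that by simp
    then show ?thesis using q(2)[of N] vertex_subset[OF pV[of N]] by auto
  qed
  have level: "real (fst u) - real i \<le> real (fst (p i))"
    "real (fst v) - (real N - real i) \<le> real (fst (p i))" if "i \<le> N" for i
    using level_along_walk[of N p 0 i] level_along_walk[of N p i N] p that by auto
  have uv_level: "\<bar>real (fst u) - real (fst v)\<bar> \<le> real N"
    using level_along_walk[of N p 0 N] p by simp
  define j where "j = (N + fst u - fst v) div 2"
  have "fst u \<le> N + fst v" "fst v \<le> N + fst u" using uv_level by linarith+
  then have j_nat: "j \<le> N" "2 * j + fst v \<le> N + fst u" "N + fst u \<le> 2 * j + 1 + fst v"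
    unfolding j_def by presburger+
  have j: "2 * real j \<le> real N + real (fst u) - real (fst v)"
    "real N + real (fst u) - real (fst v) \<le> 2 * real j + 1"
    using j_nat(2,3) by linarith+
  define b where "b = gromov_product \<X> u v - 1"
  have b: "b \<le> real (fst u) - real j" "b \<le> real (fst v) - real N + real j"
    using j by (simp_all add: b_def gromov_product_def field_simps flip: N_def)
  have "ereal (b - C * (real L + 1)) \<le> m (q (j - 0)) (q (j - j))"
  proof (rule sep_along_growing_chain[OF L, where p = "\<lambda>i. q (j - i)"])
    show "q (j - i) \<in> S" if "i \<le> j" for i using qS j_nat(1) by simp
    show "ereal (b + real i) \<le> m (q (j - i)) (q (j - Suc i))" if "i < j" for i
    proof -
      let ?l = "j - Suc i"
      have l: "?l \<le> N" "real ?l = real j - (1 + real i)" using j_nat(1) that by auto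
      have "ereal (b + real i) \<le> ereal (real (fst (p ?l)))"
        using level(1)[OF l(1)] b(1) unfolding l(2) by simp
      also have "\<dots> \<le> m (q (j - i)) (q ?l)"
        using q_sep[of ?l] sym[of "q ?l" "q (j - i)"] j_nat(1) that
        by (simp add: Suc_diff_Suc)
      finally show ?thesis .
    qed
  qed
  then have left: "ereal (b - C * (real L + 1)) \<le> m x (q j)"
    using sym[of x "q j"] by (simp add: q_def[of 0])
  have "ereal (b - C * (real L + 1)) \<le> m (q (j + 0)) (q (j + (Suc N - j)))"
  proof (rule sep_along_growing_chain[OF L, where p = "\<lambda>i. q (j + i)"])
    show "q (j + i) \<in> S" if "i \<le> Suc N - j" for i using qS that j_nat(1) by simp
    show "ereal (b + real i) \<le> m (q (j + i)) (q (j + Suc i))" if "i < Suc N - j" for i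
    proof -
      have l: "j + i \<le> N" using that by simp
      have "ereal (b + real i) \<le> ereal (real (fst (p (j + i))))"
        using level(2)[OF l] b(2) by simp
      also have "\<dots> \<le> m (q (j + i)) (q (j + Suc i))"
        using q_sep[of "j + i"] that by simp
      finally show ?thesis .
    qed
  qed
  then have right: "ereal (b - C * (real L + 1)) \<le> m (q j) y"
    using j_nat(1) by (simp add: q_def[of "Suc N"])
  have "ereal (b - C * (real L + 1) - C) \<le> m x y"
    using xy vertex_subset[OF uv(1)] vertex_subset[OF uv(2)] qS j_nat(1)
    by (intro ultra[OF _ _ _ left right]) auto
  then show ?thesis by (simp add: b_def algebra_simps)
qed

section \<open>Hyperbolicity\<close>

lemma gromov_hyperbolic_tile_graph:
  "\<exists>K::real. K \<ge> 0 \<and> (\<forall>X\<in>V. \<forall>Y\<in>V. \<forall>Z\<in>V.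
     gromov_product \<X> X Y \<ge> min (gromov_product \<X> X Z) (gromov_product \<X> Z Y) - K)"
proof -
  obtain L :: nat where L: "C \<le> real L" using real_arch_simple by blast
  define A where "A = C * (real L + 2) + 1"
  define B where "B = 4 * C + real w + 2"
  have "min (gromov_product \<X> X Z) (gromov_product \<X> Z Y) - (A + C + B) \<le> gromov_product \<X> X Y"
    if V: "X \<in> V" "Y \<in> V" "Z \<in> V" for X Y Z
  proof -
    let ?t = "min (gromov_product \<X> X Z) (gromov_product \<X> Z Y) - A"
    obtain x y where xy: "x \<in> snd X" "y \<in> snd Y" "m x y \<le> ereal (gromov_product \<X> X Y + B)"
      using exists_sep_le_gromov_product[OF V(1,2)] unfolding B_def by blast
    obtain z where z: "z \<in> snd Z" using vertex_nonempty[OF V(3)] by blast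
    have "ereal ?t \<le> ereal (gromov_product \<X> X Z - A)"
      "ereal ?t \<le> ereal (gromov_product \<X> Z Y - A)" by simp_all
    then have "ereal ?t \<le> m x z" "ereal ?t \<le> m z y"
      using gromov_product_le_sep[OF V(1,3) xy(1) z L]
        gromov_product_le_sep[OF V(3,2) z xy(2) L]
      unfolding A_def by (blast intro: order_trans)+
    moreover have "x \<in> S" "y \<in> S" "z \<in> S"
      using xy(1,2) z V[THEN vertex_subset] by auto
    ultimately have "ereal (?t - C) \<le> m x y" by (intro ultra)
    then have "ereal (?t - C) \<le> ereal (gromov_product \<X> X Y + B)"
      using xy(3) by (rule order_trans)
    then show ?thesis by simp
  qed
  moreover have "A + C + B \<ge> 0" using C_nonneg by (simp add: A_def B_def)
  ultimately show ?thesis by blast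
qed

end

theorem theorem9p1:
  fixes S :: "'a set" and w :: nat and \<X> :: "nat \<Rightarrow> 'a set set"
  assumes "comb_visual_approx S w \<X>"
  shows "\<exists>C::real. C \<ge> 0 \<and>
    (\<forall>X\<in>tile_vertices \<X>. \<forall>Y\<in>tile_vertices \<X>. \<forall>Z\<in>tile_vertices \<X>.
       gromov_product \<X> X Y \<ge> min (gromov_product \<X> X Z) (gromov_product \<X> Z Y) - C)"
proof -
  obtain C where C: "C \<ge> 0"
    "\<forall>n. \<forall>X\<in>\<X> n. \<exists>x\<in>X. \<exists>y\<in>X.
       ereal_of_enat (sep_level \<X> w x y) \<le> ereal (real n + C)"
    "\<forall>x\<in>S. \<forall>y\<in>S. \<forall>z\<in>S. ereal_of_enat (sep_level \<X> w x y)
       \<ge> min (ereal_of_enat (sep_level \<X> w x z)) (ereal_of_enat (sep_level \<X> w z y)) - ereal C"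
    using assms unfolding comb_visual_approx_def by (elim conjE exE)
  have "visual_approximation S w \<X> C"
    by (rule visual_approximation.intro[OF assms C(1)])
      (rule C(2)[rule_format] C(3)[rule_format]; assumption)+
  then show ?thesis by (rule visual_approximation.gromov_hyperbolic_tile_graph)
qed

end
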